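(* Let $\mathcal{L}=(L,\wedge,\vee,\otimes,0,1)$ be an integral $\ell$-monoid, let $\alpha$ be an arbitrary fuzzy regular expression over a finite alphabet $X$, and let $Y$ be an alphabet associated with $\alpha$. For an arbitrary nondeterministic (finite) automaton $\mathcal A=(A,X\cup Y,\delta^A,a_0,\tau^A)$ recognizing the language $\|\alpha_R\|$ we have, for all $a,b\in A$ (the supremum existing in $L$), $$R_{\mathcal A}(a,b)=\bigvee_{u\in Y^*}\varphi_\alpha^*(u)\otimes\delta^A(a,u,b).$$
   Context: **Integral $\ell$-monoid.** An algebra $(L,\wedge,\vee,\otimes,0,1)$ such that $(L,\wedge,\vee,0,1)$ is a lattice with least element $0$ and greatest element $1$ (not necessarily complete), $(L,\otimes,1)$ is a (not necessarily commutative) monoid whose unit is the greatest element $1$, $x\otimes 0=0\otimes x=0$, $x\otimes(y\vee z)=(x\otimes y)\vee(x\otimes z)$ and $(x\vee y)\otimes z=(x\otimes z)\vee(y\otimes z)$ for all $x,y,z\in L$. **Fuzzy regular expressions** over a finite alphabet $X$ are defined inductively: $\emptyset$, $\varepsilon$ (empty word) and each $x\in X$ are fuzzy regular expressions; if $\alpha,\alpha_1,\alpha_2$ are, then so are $(\lambda\alpha)$ for $\lambda\in L$, $(\alpha_1+\alpha_2)$, $(\alpha_1\alpha_2)$ and $(\alpha^* )$. A regular expression is a fuzzy regular expression without scalars; its language $\|\cdot\|$ is the usual one, regarded as a $\{0,1\}$-valued function on words. **The regular expression $\alpha_R$.** Let $K\subseteq L$ be the (finite, possibly empty) set of scalars appearing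 in $\alpha$. An alphabet associated with $\alpha$ is a set $Y$ with $Y\cap X=\emptyset$ together with a bijection $K\to Y$, $\lambda\mapsto\lambda'$. Then $\alpha_R$ is the regular expression over $X\cup Y$ obtained from $\alpha$ by replacing each scalar $\lambda$ by the letter $\lambda'$ (so scalar multiplication by $\lambda$ becomes concatenation with $\lambda'$ on the left). The map $\varphi_\alpha^*:(X\cup Y)^*\to(L,\otimes,1)$ is the monoid homomorphism with $\varphi_\alpha^*(x)=1$ for $x\in X$ and $\varphi_\alpha^*(\lambda')=\lambda$ for $\lambda'\in Y$. **Nondeterministic automata.** $\mathcal A=(A,Z,\delta^A,a_0,\tau^A)$ with $A$ a finite nonempty set, $Z$ a finite alphabet, $\delta^A:A\times Z\times A\to\{0,1\}\subseteq L$, $a_0\in A$ the initial state, $\tau^A:A\to\{0,1\}$. The map $\delta^A$ is extended to $A\times Z^*\times A$ by $\delta^A(a,\varepsilon,b)=1$ if $a=b$ and $0$ otherwise, and $\delta^A(a,ux,b)=\bigvee_{c\in A}\delta^A(a,u,c)\otimes\delta^A(c,x,b)$. It recognizes the language $L(\mathcal A)(u)=\bigvee_{a\in A}\delta^A(a_0,u,a)\otimes\tau^A(a)$. **The fuzzy relation $R_{\mathcal A}$.** A fuzzy relation on $A$ is a map $A\times A\to L$, ordered pointwise; composition is $(R\circ S)(a,b)=\bigvee_{c\in A}R(a,c)\otimes S(c,b)$; $R$ is transitive if $R(a,b)\otimes R(b,c)\le R(a,c)$ for all $a,b,c$. Define $R$ on $A$ by $R(a,a)=1$ and $R(a,b)=\bigvee_{\lambda'\in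 Y}\lambda\otimes\delta^A(a,\lambda',b)$ for $a\ne b$. Then $R_{\mathcal A}$ denotes the least transitive fuzzy relation on $A$ containing $R$; it equals $R^n=R\circ\cdots\circ R$ ($n$ factors), where $n=|A|$. *)

theory Defs
  imports Main "HOL-Library.Lub_Glb"
begin

section \<open>Integral l-monoids\<close>

class integral_l_monoid = bounded_lattice + monoid_mult + mult_zero +
  assumes bot_eq_zero: "bot = 0"
    and top_eq_one: "top = 1"
    and mult_sup_distrib_left: "x * sup y z = sup (x * y) (x * z)"
    and mult_sup_distrib_right: "sup x y * z = sup (x * z) (y * z)"

text \<open>Joins of finite families; inserting \<open>0\<close> makes the empty join \<open>0\<close>
  and changes no other join.\<close>

definition fin_join :: "('i \<Rightarrow> 'l::integral_l_monoid) \<Rightarrow> 'i set \<Rightarrow> 'l" where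
  "fin_join f I = Sup_fin (insert 0 (f ` I))"


section \<open>Regular and fuzzy regular expressions\<close>

datatype (fletters: 'z, scalars: 'l) fuzzy_regexp =
    FEmpty
  | FEps
  | FLetter 'z
  | FScale 'l "('z, 'l) fuzzy_regexp"
  | FPlus "('z, 'l) fuzzy_regexp" "('z, 'l) fuzzy_regexp"
  | FTimes "('z, 'l) fuzzy_regexp" "('z, 'l) fuzzy_regexp"
  | FStar "('z, 'l) fuzzy_regexp"

datatype 'z regexp =
    REmpty
  | REps
  | RLetter 'z
  | RPlus "'z regexp" "'z regexp"
  | RTimes "'z regexp" "'z regexp"
  | RStar "'z regexp"

primrec lang :: "'z regexp \<Rightarrow> 'z list set" where
  "lang REmpty = {}"
| "lang REps = {[]}"
| "lang (RLetter z) = {[z]}"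
| "lang (RPlus r s) = lang r \<union> lang s"
| "lang (RTimes r s) = {u @ v | u v. u \<in> lang r \<and> v \<in> lang s}"
| "lang (RStar r) = {concat us | us. set us \<subseteq> lang r}"

definition lang_fun :: "'z regexp \<Rightarrow> 'z list \<Rightarrow> 'l::integral_l_monoid" where
  "lang_fun r u = (if u \<in> lang r then 1 else 0)"


section \<open>The regular expression associated with a fuzzy regular expression\<close>

text \<open>The function \<open>p\<close> is the bijection sending a scalar to its primed letter; only its
  values on the scalars of \<open>\<alpha>\<close> matter.\<close>

definition associated_alphabet ::
    "'z set \<Rightarrow> ('z, 'l) fuzzy_regexp \<Rightarrow> 'z set \<Rightarrow> ('l \<Rightarrow> 'z) \<Rightarrow> bool" where
  "associated_alphabet X \<alpha> Y p \<longleftrightarrow> Y \<inter> X = {} \<and> bij_betw p (scalars \<alpha>) Y"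

primrec reg_of :: "('l \<Rightarrow> 'z) \<Rightarrow> ('z, 'l) fuzzy_regexp \<Rightarrow> 'z regexp" where
  "reg_of p FEmpty = REmpty"
| "reg_of p FEps = REps"
| "reg_of p (FLetter z) = RLetter z"
| "reg_of p (FScale l \<alpha>) = RTimes (RLetter (p l)) (reg_of p \<alpha>)"
| "reg_of p (FPlus \<alpha> \<beta>) = RPlus (reg_of p \<alpha>) (reg_of p \<beta>)"
| "reg_of p (FTimes \<alpha> \<beta>) = RTimes (reg_of p \<alpha>) (reg_of p \<beta>)"
| "reg_of p (FStar \<alpha>) = RStar (reg_of p \<alpha>)"

definition phi ::
    "'z set \<Rightarrow> ('z, 'l) fuzzy_regexp \<Rightarrow> ('l \<Rightarrow> 'z) \<Rightarrow> 'z \<Rightarrow> 'l::integral_l_monoid" where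
  "phi X \<alpha> p z = (if z \<in> X then 1 else inv_into (scalars \<alpha>) p z)"

definition phi_star ::
    "'z set \<Rightarrow> ('z, 'l) fuzzy_regexp \<Rightarrow> ('l \<Rightarrow> 'z) \<Rightarrow> 'z list \<Rightarrow> 'l::integral_l_monoid" where
  "phi_star X \<alpha> p u = prod_list (map (phi X \<alpha> p) u)"


section \<open>Nondeterministic automata\<close>

text \<open>The finite nonempty set of states is the type \<open>'q\<close>, of class \<open>finite\<close>.\<close>

record ('q, 'z, 'l) automaton =
  alphabet :: "'z set"
  transit :: "'q \<Rightarrow> 'z \<Rightarrow> 'q \<Rightarrow> 'l"
  initial :: 'q
  terminal :: "'q \<Rightarrow> 'l"

definition nondeterministic_automaton ::
    "('q::finite, 'z, 'l::integral_l_monoid) automaton \<Rightarrow> bool" where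
  "nondeterministic_automaton M \<longleftrightarrow>
     finite (alphabet M) \<and>
     (\<forall>a. \<forall>z\<in>alphabet M. \<forall>b. transit M a z b \<in> {0, 1}) \<and>
     (\<forall>a. terminal M a \<in> {0, 1})"

function transit_star ::
    "('q::finite, 'z, 'l::integral_l_monoid) automaton \<Rightarrow> 'q \<Rightarrow> 'z list \<Rightarrow> 'q \<Rightarrow> 'l" where
  "transit_star M a [] b = (if a = b then 1 else 0)"
| "transit_star M a (u @ [x]) b = fin_join (\<lambda>c. transit_star M a u c * transit M c x b) UNIV"
  by (auto, metis rev_exhaust)
termination
  by (relation "measure (\<lambda>(M, a, u, b). length u)") auto

definition recognized ::
    "('q::finite, 'z, 'l::integral_l_monoid) automaton \<Rightarrow> 'z list \<Rightarrow> 'l" where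
  "recognized M u = fin_join (\<lambda>a. transit_star M (initial M) u a * terminal M a) UNIV"

definition recognizes ::
    "('q::finite, 'z, 'l::integral_l_monoid) automaton \<Rightarrow> 'z regexp \<Rightarrow> bool" where
  "recognizes M r \<longleftrightarrow> (\<forall>u\<in>lists (alphabet M). recognized M u = lang_fun r u)"


section \<open>The fuzzy relation of an automaton\<close>

definition fuzzy_transitive :: "('q \<Rightarrow> 'q \<Rightarrow> 'l::integral_l_monoid) \<Rightarrow> bool" where
  "fuzzy_transitive T \<longleftrightarrow> (\<forall>a b c. T a b * T b c \<le> T a c)"

text \<open>The join over the primed letters is indexed by the scalars themselves.\<close>

definition base_rel ::
    "('z, 'l) fuzzy_regexp \<Rightarrow> ('l \<Rightarrow> 'z) \<Rightarrow> ('q::finite, 'z, 'l::integral_l_monoid) automaton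
      \<Rightarrow> 'q \<Rightarrow> 'q \<Rightarrow> 'l" where
  "base_rel \<alpha> p M a b =
     (if a = b then 1 else fin_join (\<lambda>l. l * transit M a (p l) b) (scalars \<alpha>))"

definition aut_rel ::
    "('z, 'l) fuzzy_regexp \<Rightarrow> ('l \<Rightarrow> 'z) \<Rightarrow> ('q::finite, 'z, 'l::integral_l_monoid) automaton
      \<Rightarrow> 'q \<Rightarrow> 'q \<Rightarrow> 'l" where
  "aut_rel \<alpha> p M = (LEAST T. base_rel \<alpha> p M \<le> T \<and> fuzzy_transitive T)"

end

theory Submission
  imports Defs
begin

text \<open>Since \<open>1\<close> is the greatest element, a closed walk contributes nothing to a join, so Warshall's
  elimination of intermediate states, \<open>T' a b = T a b \<squnion> T a d * T d b\<close>, turns any fuzzy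
  relation on a finite set into its least transitive extension without using completeness. Every
  entry of the result is built from entries of the given relation by finite joins and products.
  For the relation of an automaton, entries and products are dominated by the weights of
  words over \<open>Y\<close>; conversely, a word weight is at most a product of entries along its run,
  because the crisp transition values commute with everything.\<close>

section \<open>Order properties of integral l-monoids\<close>

context integral_l_monoid
begin

lemma zero_le [simp]: "0 \<le> x"
  using bot_least[of x] by (simp add: bot_eq_zero)

lemma le_one [simp]: "x \<le> 1"
  using top_greatest[of x] by (simp add: top_eq_one)

lemma mult_mono_l_monoid:
  assumes "x \<le> x'" and "y \<le> y'"
  shows "x * y \<le> x' * y'"
proof -
  have "x * y \<le> x' * y"
    using mult_sup_distrib_right[of x x' y] assms(1) by (metis sup_absorb2 sup_ge1)
  also have "\<dots> \<le> x' * y'"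
    using mult_sup_distrib_left[of x' y y'] assms(2) by (metis sup_absorb2 sup_ge1)
  finally show ?thesis .
qed

lemma mult_le_left: "x * y \<le> x"
  using mult_mono_l_monoid[of x x y 1] by simp

lemma mult_le_right: "x * y \<le> y"
  using mult_mono_l_monoid[of x 1 y y] by simp

end

section \<open>Finite joins\<close>

text \<open>One rule serves two purposes: bounding a finite join from above, and carrying crispness
  or domination over to it. The inserted \<open>0\<close> accounts for the premise
  \<open>P 0\<close>.\<close>

lemma fin_join_induct:
  assumes "finite I"
    and "P 0"
    and "\<And>x y. P x \<Longrightarrow> P y \<Longrightarrow> P (sup x y)"
    and "\<And>i. i \<in> I \<Longrightarrow> P (f i)"
  shows "P (fin_join f I)"
proof -
  have "P (Sup_fin (insert 0 (f ` J)))" if "J \<subseteq> I" for J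
    using finite_subset[OF that assms(1)] that
  proof (induction J rule: finite_induct)
    case empty
    then show ?case using assms(2) by simp
  next
    case (insert j J)
    \<comment> \<open>Moving \<open>f j\<close> in front of \<open>0\<close> keeps the remaining set
      nonempty, as the recursion of \<open>Sup_fin\<close> demands.\<close>
    then have "Sup_fin (insert 0 (f ` insert j J)) = sup (f j) (Sup_fin (insert 0 (f ` J)))"
      by (subst image_insert, subst insert_commute) (rule Sup_fin.insert, simp_all)
    then show ?case using insert assms(3,4) by simp
  qed
  then show ?thesis by (simp add: fin_join_def)
qed

lemma le_fin_join:
  assumes "finite I" and "i \<in> I"
  shows "f i \<le> fin_join f I"
  unfolding fin_join_def using assms by (intro Sup_fin.coboundedI) auto

section \<open>The least transitive extension of a fuzzy relation\<close>

text \<open>The predicate \<open>P\<close> travels through the elimination of states, so any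
  property of entries that is stable under binary joins and composition passes from \<open>R\<close>
  to its least transitive extension.\<close>

lemma ex_least_fuzzy_transitive:
  fixes R :: "'q::finite \<Rightarrow> 'q \<Rightarrow> 'l::integral_l_monoid"
  assumes base: "\<And>a b. P a b (R a b)"
    and join: "\<And>a b x y. P a b x \<Longrightarrow> P a b y \<Longrightarrow> P a b (sup x y)"
    and comp: "\<And>a b c x y. P a c x \<Longrightarrow> P c b y \<Longrightarrow> P a b (x * y)"
  shows "\<exists>T. R \<le> T \<and> fuzzy_transitive T \<and>
    (\<forall>T'. R \<le> T' \<longrightarrow> fuzzy_transitive T' \<longrightarrow> T \<le> T') \<and> (\<forall>a b. P a b (T a b))"
proof -
  \<comment> \<open>Transitivity is required only through intermediate states in \<open>S\<close>:
    for empty \<open>S\<close> the relation \<open>R\<close> itself works, and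
    \<open>S = UNIV\<close> gives full transitivity.\<close>
  have "\<exists>T. R \<le> T \<and> (\<forall>c\<in>S. \<forall>a b. T a c * T c b \<le> T a b) \<and>
      (\<forall>T'. R \<le> T' \<longrightarrow> fuzzy_transitive T' \<longrightarrow> T \<le> T') \<and> (\<forall>a b. P a b (T a b))"
    if "finite S" for S
    using that
  proof (induction S rule: finite_induct)
    case empty
    then show ?case using base by (intro exI[of _ R]) auto
  next
    case (insert d S)
    then obtain T where T: "R \<le> T" "\<And>a b c. c \<in> S \<Longrightarrow> T a c * T c b \<le> T a b"
      "\<And>T'. R \<le> T' \<Longrightarrow> fuzzy_transitive T' \<Longrightarrow> T \<le> T'" "\<And>a b. P a b (T a b)"
      by blast
    define U where "U a b = sup (T a b) (T a d * T d b)" for a b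
    have "R \<le> U"
      using T(1) by (auto simp: U_def le_fun_def intro: le_supI1)
    moreover have "U a c * U c b \<le> U a b" if c: "c \<in> insert d S" for a b c
    proof -
      \<comment> \<open>Distributivity splits \<open>U a c * U c b\<close> into four products,
        according to whether \<open>d\<close> is visited before \<open>c\<close>, after
        \<open>c\<close>, both or neither.\<close>
      have 1: "T a c * T c b \<le> U a b"
        using c T(2)[of c a b] by (auto simp: U_def intro: le_supI1)
      \<comment> \<open>For \<open>c = d\<close> the loop factor \<open>T d d\<close> is absorbed by
        integrality; otherwise \<open>c\<close> lies in \<open>S\<close> and the walk from
        \<open>a\<close> through \<open>c\<close> to \<open>d\<close> is shortened.\<close>
      have 2: "T a c * (T c d * T d b) \<le> U a b"
      proof (cases "c = d")
        case True
        then show ?thesis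
          using mult_mono_l_monoid[OF order_refl mult_le_right, of "T a d" "T d d" "T d b"]
          by (auto simp: U_def intro: le_supI2)
      next
        case False
        then show ?thesis
          using c mult_mono_l_monoid[OF T(2)[of c a d] order_refl, of "T d b"]
          by (auto simp: U_def mult.assoc intro: le_supI2)
      qed
      have 3: "T a d * T d c * T c b \<le> U a b"
      proof (cases "c = d")
        case True
        then show ?thesis
          using mult_mono_l_monoid[OF mult_le_left order_refl, of "T a d" "T d d" "T d b"]
          by (auto simp: U_def intro: le_supI2)
      next
        case False
        then show ?thesis
          using c mult_mono_l_monoid[OF order_refl T(2)[of c d b], of "T a d"]
          by (auto simp: U_def mult.assoc intro: le_supI2)
      qed
      \<comment> \<open>The closed walk from \<open>d\<close> through \<open>c\<close> back to
        \<open>d\<close> is dropped, whatever \<open>c\<close> is.\<close>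
      have 4: "T a d * T d c * (T c d * T d b) \<le> U a b"
        using mult_mono_l_monoid[OF mult_le_left mult_le_right, of "T a d" "T d c" "T c d" "T d b"]
        by (auto simp: U_def intro: le_supI2)
      show ?thesis
        using 1 2 3 4
        by (simp add: U_def[of a c] U_def[of c b] mult_sup_distrib_left mult_sup_distrib_right)
    qed
    moreover have "U \<le> T'" if T': "R \<le> T'" "fuzzy_transitive T'" for T'
    proof -
      have le: "T x y \<le> T' x y" for x y
        using T(3)[OF T'] by (simp add: le_fun_def)
      have "T x d * T d y \<le> T' x y" for x y
        using mult_mono_l_monoid[OF le le, of x d d y] T'(2)
        unfolding fuzzy_transitive_def by (blast intro: order_trans)
      with le show ?thesis by (simp add: U_def le_fun_def)
    qed
    moreover have "P a b (U a b)" for a b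
      unfolding U_def by (intro join comp[of a d _ b] T(4))
    ultimately show ?case by blast
  qed
  from this[OF finite_UNIV] obtain T where "R \<le> T" "\<forall>a b c. T a c * T c b \<le> T a b"
    "\<forall>T'. R \<le> T' \<longrightarrow> fuzzy_transitive T' \<longrightarrow> T \<le> T'" "\<forall>a b. P a b (T a b)"
    by blast
  then show ?thesis
    by (intro exI[of _ T]) (simp add: fuzzy_transitive_def)
qed

section \<open>Extended transitions and crispness\<close>

lemma transit_star_singleton [simp]: "transit_star M a [z] b = transit M a z b"
proof (rule order.antisym)
  have eq: "transit_star M a [z] b = fin_join (\<lambda>c. transit_star M a [] c * transit M c z b) UNIV"
    using transit_star.simps(2)[of M a "[]" z b] by simp
  show "transit_star M a [z] b \<le> transit M a z b"
    unfolding eq by (rule fin_join_induct) auto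
  show "transit M a z b \<le> transit_star M a [z] b"
    unfolding eq using le_fin_join[of UNIV a "\<lambda>c. transit_star M a [] c * transit M c z b"] by simp
qed

text \<open>Runs meeting at \<open>c\<close> concatenate. The induction peels off the last letter of
  \<open>v\<close>, matching the recursion of \<open>transit_star\<close>.\<close>

lemma transit_star_mult_le:
  "transit_star M a u c * transit_star M c v b \<le> transit_star M a (u @ v) b"
proof (induction v arbitrary: b rule: rev_induct)
  case Nil
  then show ?case by simp
next
  case (snoc z v)
  have "transit_star M a u c * transit_star M c (v @ [z]) b \<le> transit_star M a ((u @ v) @ [z]) b"
    unfolding transit_star.simps(2)[of M c v z b]
  proof (rule fin_join_induct[where P = "\<lambda>x. transit_star M a u c * x \<le> _"])
    fix e
    have "transit_star M a u c * (transit_star M c v e * transit M e z b)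
        \<le> transit_star M a (u @ v) e * transit M e z b"
      using mult_mono_l_monoid[OF snoc.IH order_refl] by (simp add: mult.assoc)
    also have "\<dots> \<le> transit_star M a ((u @ v) @ [z]) b"
      unfolding transit_star.simps(2) by (rule le_fin_join) auto
    finally show "transit_star M a u c * (transit_star M c v e * transit M e z b) \<le> \<dots>" .
  qed (auto simp: mult_sup_distrib_left)
  then show ?case by simp
qed

lemma transit_star_crisp:
  assumes "nondeterministic_automaton M" and "u \<in> lists (alphabet M)"
  shows "transit_star M a u b \<in> {0, 1}"
  using assms(2)
proof (induction u arbitrary: b rule: rev_induct)
  case Nil
  then show ?case by simp
next
  case (snoc z u)
  have step: "transit_star M a u c * transit M c z b \<in> {0, 1}" for c
  proof -
    have "transit_star M a u c \<in> {0, 1}" "transit M c z b \<in> {0, 1}"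
      using snoc assms(1) by (auto simp: nondeterministic_automaton_def)
    then show ?thesis by auto
  qed
  have join: "sup x y \<in> {0, 1}" if "x \<in> {0, 1}" "y \<in> {0, 1}" for x y :: 'c
    using that by (auto simp: sup_absorb1 sup_absorb2)
  show ?case
    unfolding transit_star.simps(2)
    by (rule fin_join_induct[where P = "\<lambda>x. x \<in> {0, 1}", OF _ _ join step]) simp_all
qed

text \<open>Both \<open>0\<close> and \<open>1\<close> are central, which stands in for
  commutativity when a transition value must pass the weight of a word.\<close>

lemma crisp_mult_left_commute:
  fixes x y z :: "'l::integral_l_monoid"
  assumes "x \<in> {0, 1}"
  shows "x * (y * z) = y * (x * z)"
  using assms by auto

section \<open>Weights of words\<close>

lemma phi_star_append: "phi_star X \<alpha> p (u @ v) = phi_star X \<alpha> p u * phi_star X \<alpha> p v"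
  by (simp add: phi_star_def)

lemma finite_scalars: "finite (scalars \<alpha>)"
  by (induction \<alpha>) auto

lemma phi_primed:
  assumes "associated_alphabet X \<alpha> Y p" and "l \<in> scalars \<alpha>"
  shows "phi X \<alpha> p (p l) = l" and "p l \<in> Y"
  using assms by (auto simp: associated_alphabet_def phi_def bij_betw_def)

definition word_weight ::
    "'z set \<Rightarrow> ('z, 'l) fuzzy_regexp \<Rightarrow> ('l \<Rightarrow> 'z) \<Rightarrow>
      ('q::finite, 'z, 'l::integral_l_monoid) automaton \<Rightarrow> 'q \<Rightarrow> 'z list \<Rightarrow> 'q \<Rightarrow> 'l" where
  "word_weight X \<alpha> p M a u b = phi_star X \<alpha> p u * transit_star M a u b"

text \<open>The crisp value of the run on \<open>u\<close> moves past
  \<open>phi_star X \<alpha> p v\<close>, which brings the two monoid values together and the two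
  transition values together.\<close>

lemma word_weight_mult_le:
  assumes "nondeterministic_automaton M" and "u \<in> lists (alphabet M)"
  shows "word_weight X \<alpha> p M a u c * word_weight X \<alpha> p M c v b \<le> word_weight X \<alpha> p M a (u @ v) b"
proof -
  have "transit_star M a u c * (phi_star X \<alpha> p v * transit_star M c v b)
      = phi_star X \<alpha> p v * (transit_star M a u c * transit_star M c v b)"
    by (rule crisp_mult_left_commute[OF transit_star_crisp[OF assms]])
  then have "word_weight X \<alpha> p M a u c * word_weight X \<alpha> p M c v b
      = phi_star X \<alpha> p (u @ v) * (transit_star M a u c * transit_star M c v b)"
    by (simp add: word_weight_def phi_star_append mult.assoc)
  also have "\<dots> \<le> word_weight X \<alpha> p M a (u @ v) b"
    unfolding word_weight_def by (rule mult_mono_l_monoid[OF order_refl transit_star_mult_le])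
  finally show ?thesis .
qed

lemma word_weight_letter_le_base_rel:
  assumes "associated_alphabet X \<alpha> Y p" and "y \<in> Y"
  shows "word_weight X \<alpha> p M c [y] b \<le> base_rel \<alpha> p M c b"
proof (cases "c = b")
  case True
  then show ?thesis by (simp add: base_rel_def)
next
  case False
  obtain l where l: "l \<in> scalars \<alpha>" "y = p l"
    using assms by (auto simp: associated_alphabet_def bij_betw_def)
  then have "word_weight X \<alpha> p M c [y] b = l * transit M c (p l) b"
    by (simp add: word_weight_def phi_star_def phi_primed[OF assms(1)])
  then show ?thesis
    using False l le_fin_join[OF finite_scalars, of l \<alpha> "\<lambda>l. l * transit M c (p l) b"]
    by (simp add: base_rel_def)
qed

text \<open>This is the upper bound half. Splitting off the last letter at its source state
  \<open>c\<close> bounds each term of the join by \<open>T a c * T c b\<close>, and transitivity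
  absorbs the product.\<close>

lemma word_weight_le_transitive:
  assumes "associated_alphabet X \<alpha> Y p" and "nondeterministic_automaton M" and "Y \<subseteq> alphabet M"
    and "base_rel \<alpha> p M \<le> T" and "fuzzy_transitive T" and "u \<in> lists Y"
  shows "word_weight X \<alpha> p M a u b \<le> T a b"
  using assms(6)
proof (induction u arbitrary: b rule: rev_induct)
  case Nil
  have "base_rel \<alpha> p M a b \<le> T a b"
    using assms(4) by (simp add: le_fun_def)
  \<comment> \<open>The empty word weighs \<open>1\<close> on the diagonal, where
    \<open>base_rel\<close> is \<open>1\<close>, and \<open>0\<close> elsewhere.\<close>
  then show ?case by (auto simp: word_weight_def phi_star_def base_rel_def)
next
  case (snoc y u)
  then have u: "u \<in> lists Y" and y: "y \<in> Y" by auto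
  then have "u \<in> lists (alphabet M)" using assms(3) by auto
  then have comm: "transit_star M a u c * (x * y) = x * (transit_star M a u c * y)" for c x y
    by (intro crisp_mult_left_commute transit_star_crisp[OF assms(2)])
  show ?case
    unfolding word_weight_def transit_star.simps(2)
  proof (rule fin_join_induct[where P = "\<lambda>x. phi_star X \<alpha> p (u @ [y]) * x \<le> _"])
    fix c
    have "phi_star X \<alpha> p (u @ [y]) * (transit_star M a u c * transit M c y b)
        = word_weight X \<alpha> p M a u c * word_weight X \<alpha> p M c [y] b"
      by (simp add: word_weight_def phi_star_append comm mult.assoc)
    also have "\<dots> \<le> T a c * T c b"
      using word_weight_letter_le_base_rel[OF assms(1) y, of M c b] assms(4)
      by (intro mult_mono_l_monoid snoc.IH u) (auto simp: le_fun_def intro: order_trans)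
    also have "\<dots> \<le> T a b"
      using assms(5) by (simp add: fuzzy_transitive_def)
    finally show "phi_star X \<alpha> p (u @ [y]) * (transit_star M a u c * transit M c y b) \<le> T a b" .
  qed (auto simp: mult_sup_distrib_left)
qed

text \<open>Domination in every two-sided context \<open>l * _ * r\<close> makes the notion compatible with products;
  plain domination by all upper bounds would not be, as infinite joins need not distribute.\<close>

definition dominated :: "'l::integral_l_monoid set \<Rightarrow> 'l \<Rightarrow> bool" where
  "dominated V x \<longleftrightarrow> (\<forall>l r z. (\<forall>v\<in>V. l * v * r \<le> z) \<longrightarrow> l * x * r \<le> z)"

lemma dominated_mem: "x \<in> V \<Longrightarrow> dominated V x"
  by (auto simp: dominated_def)

lemma dominated_zero: "dominated V 0"
  by (simp add: dominated_def)

lemma dominated_sup: "dominated V x \<Longrightarrow> dominated V y \<Longrightarrow> dominated V (sup x y)"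
  by (simp add: dominated_def mult_sup_distrib_left mult_sup_distrib_right)

text \<open>The factors are replaced one at a time: first \<open>y\<close> in the context of
  \<open>l * v\<close> and \<open>r\<close>, then \<open>x\<close> in the context of
  \<open>l\<close> and \<open>y * r\<close>.\<close>

lemma dominated_mult:
  assumes "dominated V x" and "dominated W y"
    and "\<And>v w. v \<in> V \<Longrightarrow> w \<in> W \<Longrightarrow> \<exists>t\<in>U. v * w \<le> t"
  shows "dominated U (x * y)"
  unfolding dominated_def
proof (intro allI impI)
  fix l r z
  assume U: "\<forall>t\<in>U. l * t * r \<le> z"
  have "l * v * w * r \<le> z" if vw: "v \<in> V" "w \<in> W" for v w
  proof -
    obtain t where t: "t \<in> U" "v * w \<le> t" using assms(3) vw by blast
    then have "l * (v * w) * r \<le> l * t * r"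
      by (intro mult_mono_l_monoid order_refl)
    with t(1) U show ?thesis by (auto simp: mult.assoc intro: order_trans)
  qed
  then have "l * v * y * r \<le> z" if "v \<in> V" for v
    using assms(2) that unfolding dominated_def by blast
  then have "l * x * (y * r) \<le> z"
    using assms(1)[unfolded dominated_def, rule_format, of l "y * r" z] by (simp add: mult.assoc)
  then show "l * (x * y) * r \<le> z" by (simp add: mult.assoc)
qed

lemma dominated_le:
  assumes "dominated V x" and "\<And>v. v \<in> V \<Longrightarrow> v \<le> z"
  shows "x \<le> z"
  using assms(1)[unfolded dominated_def, rule_format, of 1 1 z] assms(2) by simp

text \<open>A diagonal entry is the weight of the empty word; any other entry is a finite join of
  weights of one-letter words.\<close>

lemma base_rel_dominated:
  assumes "associated_alphabet X \<alpha> Y p"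
  shows "dominated ((\<lambda>u. word_weight X \<alpha> p M a u b) ` lists Y) (base_rel \<alpha> p M a b)"
proof (cases "a = b")
  case True
  then show ?thesis
    by (intro dominated_mem image_eqI[of _ _ "[]"])
      (simp_all add: base_rel_def word_weight_def phi_star_def)
next
  case False
  have step: "dominated ((\<lambda>u. word_weight X \<alpha> p M a u b) ` lists Y) (l * transit M a (p l) b)"
    if "l \<in> scalars \<alpha>" for l
    using phi_primed[OF assms that]
    by (intro dominated_mem image_eqI[of _ _ "[p l]"]) (simp_all add: word_weight_def phi_star_def)
  have "dominated ((\<lambda>u. word_weight X \<alpha> p M a u b) ` lists Y)
      (fin_join (\<lambda>l. l * transit M a (p l) b) (scalars \<alpha>))"
    by (rule fin_join_induct[OF finite_scalars dominated_zero dominated_sup step])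
  with False show ?thesis by (simp add: base_rel_def)
qed

theorem theorem4p3:
  fixes X Y :: "'z set"
    and \<alpha> :: "('z, 'l::integral_l_monoid) fuzzy_regexp"
    and p :: "'l \<Rightarrow> 'z"
    and M :: "('q::finite, 'z, 'l) automaton"
    and a b :: 'q
  assumes "finite X"
    and "fletters \<alpha> \<subseteq> X"
    and "associated_alphabet X \<alpha> Y p"
    and "nondeterministic_automaton M"
    and "alphabet M = X \<union> Y"
    and "recognizes M (reg_of p \<alpha>)"
  shows "isLub UNIV ((\<lambda>u. phi_star X \<alpha> p u * transit_star M a u b) ` lists Y) (aut_rel \<alpha> p M a b)"
proof -
  define V where "V a b = (\<lambda>u. word_weight X \<alpha> p M a u b) ` lists Y" for a b
  have Y: "Y \<subseteq> alphabet M" using assms(5) by simp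
  have word_mult: "\<exists>t\<in>V a b. v * w \<le> t" if vw: "v \<in> V a c" "w \<in> V c b" for a b c v w
  proof -
    obtain u1 u2 where u: "u1 \<in> lists Y" "u2 \<in> lists Y"
      and "v = word_weight X \<alpha> p M a u1 c" "w = word_weight X \<alpha> p M c u2 b"
      using vw by (auto simp: V_def)
    moreover have "u1 \<in> lists (alphabet M)" using u(1) Y by auto
    ultimately have "v * w \<le> word_weight X \<alpha> p M a (u1 @ u2) b"
      using word_weight_mult_le[OF assms(4)] by blast
    moreover have "word_weight X \<alpha> p M a (u1 @ u2) b \<in> V a b"
      unfolding V_def using u by (intro imageI) simp
    ultimately show ?thesis by blast
  qed
  have comp: "dominated (V a b) (x * y)" if "dominated (V a c) x" "dominated (V c b) y"
    for a b c x y
    by (rule dominated_mult[OF that]) (rule word_mult)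
  have "\<exists>T. base_rel \<alpha> p M \<le> T \<and> fuzzy_transitive T \<and>
      (\<forall>T'. base_rel \<alpha> p M \<le> T' \<longrightarrow> fuzzy_transitive T' \<longrightarrow> T \<le> T') \<and>
      (\<forall>a b. dominated (V a b) (T a b))"
    \<comment> \<open>Indexing domination by the end states lets \<open>comp\<close> join words at a
      common state \<open>c\<close>.\<close>
    by (rule ex_least_fuzzy_transitive[where P = "\<lambda>a b. dominated (V a b)"])
      (fact base_rel_dominated[OF assms(3), of M, folded V_def] dominated_sup comp)+
  then obtain T where T: "base_rel \<alpha> p M \<le> T" "fuzzy_transitive T"
    "\<And>T'. base_rel \<alpha> p M \<le> T' \<Longrightarrow> fuzzy_transitive T' \<Longrightarrow> T \<le> T'"
    and dom: "\<And>a b. dominated (V a b) (T a b)"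
    by blast
  \<comment> \<open>The \<open>LEAST\<close> in \<open>aut_rel\<close> has a meaning only once a
    least element is exhibited, and \<open>T\<close> is that witness.\<close>
  have "aut_rel \<alpha> p M = T"
    unfolding aut_rel_def using T by (intro Least_equality) auto
  moreover have "isLub UNIV (V a b) (T a b)"
  proof (intro isLubI2)
    show "isUb UNIV (V a b) (T a b)"
      using word_weight_le_transitive[OF assms(3,4) Y T(1,2)]
      by (intro isUbI setleI) (auto simp: V_def)
    \<comment> \<open>Domination in the trivial context \<open>1 * _ * 1\<close> puts
      \<open>T a b\<close> below every upper bound of the weights.\<close>
    show "T a b <=* {z. isUb UNIV (V a b) z}"
      by (intro setgeI) (auto simp: isUb_def setle_def intro: dominated_le[OF dom])
  qed
  ultimately show ?thesis
    by (simp add: V_def word_weight_def)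
qed

end
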